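(* Let $d>3$, let $H$ be an order $d$ complex Hadamard matrix and let $v\in\mathbb{C}$. Then $H(v)$ is a set of $d^2$ equiangular lines in $\mathbb{C}^d$ if and only if $d=8$, $H$ is equivalent to a real Hadamard matrix, and $v\in\{-1\pm 2i\}$.
   Context: An order $d$ complex Hadamard matrix is a $d\times d$ matrix $H$ with all entries in $\mathbb{C}$ of magnitude $1$ such that $HH^\dagger = dI_d$, where $H^\dagger$ is the conjugate transpose. If all entries lie in $\{1,-1\}$, $H$ is a real Hadamard matrix. Two complex Hadamard matrices $H,H'$ are equivalent if $H'=DPHP'D'$ for some diagonal unitary matrices $D,D'$ and permutation matrices $P,P'$. Regard the rows of $H$ as vectors in $\mathbb{C}^d$. For $j=1,\dots,d$ let $H_j(v)$ be the collection of $d$ vectors obtained by multiplying coordinate $j$ of each row of $H$ by $v$, and $H(v)=\bigcup_{j=1}^d H_j(v)$, a collection of $d^2$ vectors. Using the standard Hermitian inner product, "$H(v)$ is a set of $d^2$ equiangular lines" means the $d^2$ vectors span $d^2$ distinct lines through the origin and $|\langle\mathbf{x},\mathbf{y}\rangle|$ is the same constant for every pair of distinct vectors $\mathbf{x},\mathbf{y}$ of $H(v)$. *)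

theory Defs
  imports Complex_Main "Jordan_Normal_Form.Schur_Decomposition"
begin

definition complex_hadamard :: "nat \<Rightarrow> complex mat \<Rightarrow> bool" where
  "complex_hadamard d H \<longleftrightarrow>
     H \<in> carrier_mat d d \<and>
     (\<forall>i<d. \<forall>j<d. cmod (H $$ (i, j)) = 1) \<and>
     H * mat_adjoint H = of_nat d \<cdot>\<^sub>m 1\<^sub>m d"

definition real_hadamard :: "nat \<Rightarrow> complex mat \<Rightarrow> bool" where
  "real_hadamard d H \<longleftrightarrow>
     complex_hadamard d H \<and> (\<forall>i<d. \<forall>j<d. H $$ (i, j) \<in> {1, -1})"

definition unitary_mat :: "nat \<Rightarrow> complex mat \<Rightarrow> bool" where
  "unitary_mat d U \<longleftrightarrow>
     U \<in> carrier_mat d d \<and> U * mat_adjoint U = 1\<^sub>m d \<and> mat_adjoint U * U = 1\<^sub>m d"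

definition permutation_mat :: "nat \<Rightarrow> complex mat \<Rightarrow> bool" where
  "permutation_mat d P \<longleftrightarrow>
     (\<exists>\<sigma>. \<sigma> permutes {0..<d} \<and> P = mat d d (\<lambda>(i, j). if j = \<sigma> i then 1 else 0))"

definition hadamard_equivalent :: "nat \<Rightarrow> complex mat \<Rightarrow> complex mat \<Rightarrow> bool" where
  "hadamard_equivalent d H H' \<longleftrightarrow>
     complex_hadamard d H \<and> complex_hadamard d H' \<and>
     (\<exists>D D' P P'.
        diagonal_mat D \<and> unitary_mat d D \<and> diagonal_mat D' \<and> unitary_mat d D' \<and>
        permutation_mat d P \<and> permutation_mat d P' \<and>
        H' = D * P * H * P' * D')"

definition scale_coord :: "nat \<Rightarrow> complex \<Rightarrow> complex vec \<Rightarrow> complex vec" where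
  "scale_coord j v x = vec (dim_vec x) (\<lambda>k. if k = j then v * x $ k else x $ k)"

text \<open>Coordinates and rows are indexed from \<open>0\<close> to \<open>d - 1\<close>.  The collections \<open>H\<^sub>j(v)\<close> and
  \<open>H(v)\<close> are rendered as sets; coinciding vectors are ruled out by the cardinality condition in
  \<open>equiangular_lines\<close> below.\<close>

definition hadamard_coord_vectors :: "complex mat \<Rightarrow> nat \<Rightarrow> complex \<Rightarrow> complex vec set" where
  "hadamard_coord_vectors H j v = {scale_coord j v (row H i) | i. i < dim_row H}"

definition hadamard_vectors :: "complex mat \<Rightarrow> complex \<Rightarrow> complex vec set" where
  "hadamard_vectors H v = (\<Union>j<dim_col H. hadamard_coord_vectors H j v)"

definition complex_line :: "complex vec \<Rightarrow> complex vec set" where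
  "complex_line x = {a \<cdot>\<^sub>v x | a. True}"

text \<open>\<open>equiangular_lines d n S\<close>: \<open>S\<close> consists of \<open>n\<close> nonzero vectors of \<open>\<complex>\<^sup>d\<close> spanning \<open>n\<close> distinct
  lines, and \<open>\<bar>\<langle>x, y\<rangle>\<bar>\<close> is the same for all pairs of distinct vectors of \<open>S\<close>.\<close>

definition equiangular_lines :: "nat \<Rightarrow> nat \<Rightarrow> complex vec set \<Rightarrow> bool" where
  "equiangular_lines d n S \<longleftrightarrow>
     S \<subseteq> carrier_vec d \<and> finite S \<and> card S = n \<and>
     0\<^sub>v d \<notin> S \<and> inj_on complex_line S \<and>
     (\<exists>c. \<forall>x\<in>S. \<forall>y\<in>S. x \<noteq> y \<longrightarrow> cmod (x \<bullet>c y) = c)"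

end

(* Put w = v - 1 and, for two distinct rows of H, let x_k be the quotient of their k-th entries.
   The three kinds of inner products between vectors of H(v) have moduli | |v|^2 - 1 |,
   | d - 2 + 2 Re v | and |w x_j + cnj w x_j'|, and the square of the last is
   2 |w|^2 + 2 Re (w^2 z) with z = x_j cnj x_j'. Interchanging j and j' conjugates z, so if
   Re (w^2 z) is constant then so is Re (w^2) Re z. Since more than three unimodular numbers with sum
   0 cannot have equal pairwise real inner products in the plane, Re (w^2) = 0, whence every z is
   real. The numbers z are the Haagerup invariants of H, and they are all real iff H is equivalent to
   a real matrix. The remaining equations Re (w^2) = 0 and (|v|^2 - 1)^2 = 2 |w|^2 determine v, and
   comparing the first two moduli determines d. *)

theory Submission
  imports Defs
begin

section \<open>Unimodular complex numbers\<close>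

lemma mult_cnj_eq_1_iff: "z * cnj z = 1 \<longleftrightarrow> cmod z = 1"
proof -
  have "z * cnj z = of_real ((cmod z)\<^sup>2)"
    by (rule complex_norm_square[symmetric])
  then show ?thesis
    by (simp only: of_real_eq_1_iff abs_square_eq_1 abs_norm_cancel)
qed

lemma unimodular_real_iff: "cmod z = 1 \<and> Im z = 0 \<longleftrightarrow> z \<in> {1, -1}"
  by (auto simp: complex_eq_iff cmod_def power2_eq_1_iff)

lemma cmod_mult_add_cnj_mult_squared:
  assumes "cmod x = 1" "cmod y = 1"
  shows "(cmod (w * x + cnj w * y))\<^sup>2 = 2 * (cmod w)\<^sup>2 + 2 * Re (w\<^sup>2 * (x * cnj y))"
proof -
  have "(cmod (w * x + cnj w * y))\<^sup>2
      = (cmod (w * x))\<^sup>2 + (cmod (cnj w * y))\<^sup>2 + 2 * Re (w * x * cnj (cnj w * y))"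
    unfolding cmod_power2 by (simp add: algebra_simps power2_eq_square)
  then show ?thesis
    by (simp add: norm_mult assms power2_eq_square mult_ac)
qed

lemma eq_or_eq_cnj_if_same_Re:
  assumes "cmod x = cmod y" "Re x = Re y"
  shows "x = y \<or> x = cnj y"
proof -
  have "(Re x)\<^sup>2 + (Im x)\<^sup>2 = (Re y)\<^sup>2 + (Im y)\<^sup>2"
    using assms(1) by (simp flip: cmod_power2)
  then show ?thesis
    using assms(2) by (simp add: complex_eq_iff power2_eq_iff)
qed

lemma equal_pair_if_Re_ratios_const:
  fixes x :: "'a \<Rightarrow> complex"
  assumes card: "card A > 3" and unimodular: "\<And>k. k \<in> A \<Longrightarrow> cmod (x k) = 1"
    and Re_const: "\<And>j k. j \<in> A \<Longrightarrow> k \<in> A \<Longrightarrow> j \<noteq> k \<Longrightarrow> Re (x j * cnj (x k)) = t"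
  obtains j k where "j \<in> A" "k \<in> A" "j \<noteq> k" "x j = x k"
proof -
  obtain a where a: "a \<in> A"
    using card by fastforce
  then have "card (A - {a}) \<ge> 3"
    using card by simp
  then obtain B where B: "B \<subseteq> A - {a}" "card B = 3"
    using obtain_subset_with_card_n by metis
  then obtain p q r where pqr: "B = {p, q, r}" "p \<noteq> q" "q \<noteq> r" "p \<noteq> r"
    using card_3_iff by metis
  define z where "z k = x k * cnj (x a)" for k
  have "cmod (z k) = 1" "Re (z k) = t" if "k \<in> B" for k
    using unimodular Re_const that a B(1) by (auto simp: z_def norm_mult simp del: times_complex.sel)
  then have "z p = z q \<or> z p = z r \<or> z q = z r"
    using eq_or_eq_cnj_if_same_Re[of "z p" "z q"] eq_or_eq_cnj_if_same_Re[of "z p" "z r"] pqr(1) by auto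
  moreover have "x j = x k" if "z j = z k" for j k
    using that unimodular[OF a] by (auto simp: z_def)
  ultimately show thesis
    using that B(1) pqr by blast
qed

lemma no_unimodular_simplex_in_plane:
  fixes x :: "'a \<Rightarrow> complex"
  assumes card: "card A > 3" and unimodular: "\<And>k. k \<in> A \<Longrightarrow> cmod (x k) = 1"
    and sum_0: "sum x A = 0"
    and Re_const: "\<And>j k. j \<in> A \<Longrightarrow> k \<in> A \<Longrightarrow> j \<noteq> k \<Longrightarrow> Re (x j * cnj (x k)) = t"
  shows False
proof -
  have self: "x k * cnj (x k) = 1" if "k \<in> A" for k
    using unimodular that by (simp add: mult_cnj_eq_1_iff)
  obtain j k where jk: "j \<in> A" "k \<in> A" "j \<noteq> k" "x j = x k"
    using equal_pair_if_Re_ratios_const[of A x t, OF card unimodular Re_const] by blast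
  then have "t = 1"
    using Re_const[OF jk(1-3)] self[OF jk(2)] by simp
  then have "Re (x l * cnj (x j)) = 1" if "l \<in> A" for l
    using Re_const[OF that jk(1)] self[OF jk(1)] by (cases "l = j") auto
  then have "Re (\<Sum>l\<in>A. x l * cnj (x j)) = card A"
    by simp
  moreover have "(\<Sum>l\<in>A. x l * cnj (x j)) = 0"
    using sum_0 by (simp flip: sum_distrib_right)
  ultimately show False
    using card by simp
qed

lemma Re_mult_ratios_const_imp_zero:
  fixes x :: "'a \<Rightarrow> complex"
  assumes card: "card A > 3" and unimodular: "\<And>k. k \<in> A \<Longrightarrow> cmod (x k) = 1"
    and sum_0: "sum x A = 0"
    and Re_const: "\<And>j k. j \<in> A \<Longrightarrow> k \<in> A \<Longrightarrow> j \<noteq> k \<Longrightarrow> Re (u * (x j * cnj (x k))) = t"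
  shows "Re u = 0" "t = 0"
proof -
  have Re_prod: "Re u * Re (x j * cnj (x k)) = t" if "j \<in> A" "k \<in> A" "j \<noteq> k" for j k
    \<comment> \<open>Interchanging \<open>j\<close> and \<open>k\<close> conjugates the ratio.\<close>
    using Re_const[of j k] Re_const[of k j] that by (simp add: algebra_simps)
  show "Re u = 0"
  proof (rule ccontr)
    assume "Re u \<noteq> 0"
    then have "Re (x j * cnj (x k)) = t / Re u" if "j \<in> A" "k \<in> A" "j \<noteq> k" for j k
      using Re_prod[OF that] by (simp add: field_simps)
    then show False
      using no_unimodular_simplex_in_plane[OF card unimodular sum_0] by blast
  qed
  moreover obtain j k where "j \<in> A" "k \<in> A" "j \<noteq> k"
    using card card_le_Suc0_iff_eq[of A] card_ge_0_finite[of A] by fastforce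
  ultimately show "t = 0"
    using Re_prod by auto
qed

section \<open>Equivalence of Hadamard matrices\<close>

lemma index_mat_adjoint:
  "i < dim_col A \<Longrightarrow> j < dim_row A \<Longrightarrow> mat_adjoint A $$ (i, j) = conjugate (A $$ (j, i))"
  by (simp add: mat_adjoint_def mat_of_rows_def)

lemma mat_adjoint_mat_diag: "mat_adjoint (mat_diag d f) = mat_diag d (\<lambda>i. conjugate (f i))"
  by (rule eq_matI) (auto simp: index_mat_adjoint mat_diag_def, simp_all add: mat_adjoint_def)

lemma mat_diag_eq_one_iff: "mat_diag d f = 1\<^sub>m d \<longleftrightarrow> (\<forall>i<d. f i = 1)"
  by (auto simp: mat_diag_def mat_eq_iff)

lemma diagonal_mat_eq_mat_diag:
  "D \<in> carrier_mat d d \<Longrightarrow> diagonal_mat D \<Longrightarrow> D = mat_diag d (\<lambda>i. D $$ (i, i))"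
  by (rule eq_matI) (auto simp: diagonal_mat_def mat_diag_def)

lemma diagonal_unitary_mat_iff:
  "diagonal_mat D \<and> unitary_mat d D \<longleftrightarrow> (\<exists>f. (\<forall>i<d. cmod (f i) = 1) \<and> D = mat_diag d f)"
proof -
  have "unitary_mat d (mat_diag d f) \<longleftrightarrow> (\<forall>i<d. cmod (f i) = 1)" for f
    by (auto simp: unitary_mat_def mat_adjoint_mat_diag mat_diag_eq_one_iff mult_cnj_eq_1_iff
        mult.commute[of "cnj _"])
  moreover have "diagonal_mat (mat_diag d f)" for f :: "nat \<Rightarrow> complex"
    by (simp add: diagonal_mat_def mat_diag_def)
  moreover have "\<exists>f. D = mat_diag d f" if "diagonal_mat D" "unitary_mat d D"
    using that diagonal_mat_eq_mat_diag by (auto simp: unitary_mat_def)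
  ultimately show ?thesis
    by blast
qed

definition mat_of_permutation :: "nat \<Rightarrow> (nat \<Rightarrow> nat) \<Rightarrow> 'a::semiring_1 mat" where
  "mat_of_permutation d \<sigma> = mat d d (\<lambda>(i, j). if j = \<sigma> i then 1 else 0)"

lemma mat_of_permutation_carrier [simp]: "mat_of_permutation d \<sigma> \<in> carrier_mat d d"
  by (simp add: mat_of_permutation_def)

lemma permutation_mat_iff:
  "permutation_mat d P \<longleftrightarrow> (\<exists>\<sigma>. \<sigma> permutes {0..<d} \<and> P = mat_of_permutation d \<sigma>)"
  by (simp add: permutation_mat_def mat_of_permutation_def)

lemma permutes_less: "\<sigma> permutes {0..<d} \<Longrightarrow> i < d \<Longrightarrow> \<sigma> i < d" for d :: nat
  using permutes_in_image[of \<sigma> "{0..<d}" i] by simp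

lemma mat_of_permutation_mult_left:
  assumes "\<sigma> permutes {0..<d}" "A \<in> carrier_mat d n"
  shows "mat_of_permutation d \<sigma> * A = mat d n (\<lambda>(i, j). A $$ (\<sigma> i, j))"
  using assms(2) permutes_less[OF assms(1)]
  by (intro eq_matI)
    (auto simp: mat_of_permutation_def scalar_prod_def if_distrib[of "\<lambda>x. x * _"] cong: if_cong)

lemma mat_of_permutation_mult_right:
  assumes "\<sigma> permutes {0..<d}" "A \<in> carrier_mat n d"
  shows "A * mat_of_permutation d \<sigma> = mat n d (\<lambda>(i, j). A $$ (i, inv_into UNIV \<sigma> j))"
proof -
  have "j = \<sigma> k \<longleftrightarrow> k = inv_into UNIV \<sigma> j" for j k
    using permutes_inv_eq[OF assms(1), of j k] by auto
  then show ?thesis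
    using assms(2) permutes_less[OF permutes_inv[OF assms(1)]]
    by (intro eq_matI)
      (auto simp: mat_of_permutation_def scalar_prod_def if_distrib[of "\<lambda>x. _ * x"] cong: if_cong)
qed

lemma monomial_mult_mat_mult_monomial:
  assumes A: "A \<in> carrier_mat d d" and \<sigma>: "\<sigma> permutes {0..<d}" and \<tau>: "\<tau> permutes {0..<d}"
  shows "mat_diag d \<alpha> * mat_of_permutation d \<sigma> * A * mat_of_permutation d \<tau> * mat_diag d \<beta>
    = mat d d (\<lambda>(i, j). \<alpha> i * A $$ (\<sigma> i, inv_into UNIV \<tau> j) * \<beta> j)"
proof -
  have "mat_diag d \<alpha> * mat_of_permutation d \<sigma> * A = mat_diag d \<alpha> * (mat_of_permutation d \<sigma> * A)"
    using A by (intro assoc_mult_mat[of _ d d _ d _ d]) auto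
  also have "\<dots> = mat d d (\<lambda>(i, j). \<alpha> i * A $$ (\<sigma> i, j))"
    using A \<sigma> by (auto simp: mat_of_permutation_mult_left mat_diag_mult_left[of _ d d])
  finally show ?thesis
    using permutes_less[OF permutes_inv[OF \<tau>]]
    by (auto simp: mat_of_permutation_mult_right[OF \<tau>, of _ d] mat_diag_mult_right[of _ d d])
qed

lemma monomial_factorization_iff:
  assumes H: "H \<in> carrier_mat d d"
  shows "(\<exists>D D' P P'.
      diagonal_mat D \<and> unitary_mat d D \<and> diagonal_mat D' \<and> unitary_mat d D' \<and>
      permutation_mat d P \<and> permutation_mat d P' \<and> K = D * P * H * P' * D') \<longleftrightarrow>
    (\<exists>\<sigma> \<tau> \<alpha> \<beta>. \<sigma> permutes {0..<d} \<and> \<tau> permutes {0..<d} \<and>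
      (\<forall>i<d. cmod (\<alpha> i) = 1) \<and> (\<forall>j<d. cmod (\<beta> j) = 1) \<and>
      K = mat d d (\<lambda>(i, j). \<alpha> i * H $$ (\<sigma> i, \<tau> j) * \<beta> j))"
    (is "?factored \<longleftrightarrow> ?entrywise")
proof
  assume ?factored
  then obtain D D' P P' where "diagonal_mat D \<and> unitary_mat d D" "diagonal_mat D' \<and> unitary_mat d D'"
    "permutation_mat d P" "permutation_mat d P'" and K: "K = D * P * H * P' * D'"
    by blast
  then obtain \<sigma> \<tau> \<alpha> \<beta> where \<sigma>: "\<sigma> permutes {0..<d}" and \<tau>: "\<tau> permutes {0..<d}"
    and unimodular: "\<forall>i<d. cmod (\<alpha> i) = 1" "\<forall>j<d. cmod (\<beta> j) = 1"
    and factors: "D = mat_diag d \<alpha>" "P = mat_of_permutation d \<sigma>" "P' = mat_of_permutation d \<tau>"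
      "D' = mat_diag d \<beta>"
    unfolding diagonal_unitary_mat_iff permutation_mat_iff by blast
  have "K = mat d d (\<lambda>(i, j). \<alpha> i * H $$ (\<sigma> i, inv_into UNIV \<tau> j) * \<beta> j)"
    unfolding K factors by (rule monomial_mult_mat_mult_monomial[OF H \<sigma> \<tau>])
  then show ?entrywise
    using \<sigma> permutes_inv[OF \<tau>] unimodular by blast
next
  assume ?entrywise
  then obtain \<sigma> \<tau> \<alpha> \<beta> where \<sigma>: "\<sigma> permutes {0..<d}" and \<tau>: "\<tau> permutes {0..<d}"
    and unimodular: "\<forall>i<d. cmod (\<alpha> i) = 1" "\<forall>j<d. cmod (\<beta> j) = 1"
    and K: "K = mat d d (\<lambda>(i, j). \<alpha> i * H $$ (\<sigma> i, \<tau> j) * \<beta> j)"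
    by blast
  let ?P = "mat_of_permutation d \<sigma>" and ?P' = "mat_of_permutation d (inv_into UNIV \<tau>)"
  have "K = mat_diag d \<alpha> * ?P * H * ?P' * mat_diag d \<beta>"
    using monomial_mult_mat_mult_monomial[OF H \<sigma> permutes_inv[OF \<tau>]]
    by (simp add: K permutes_inv_inv[OF \<tau>])
  moreover have "permutation_mat d ?P" "permutation_mat d ?P'"
    using \<sigma> permutes_inv[OF \<tau>] permutation_mat_iff by blast+
  ultimately show ?factored
    using unimodular diagonal_unitary_mat_iff by blast
qed

lemma hadamard_equivalent_iff:
  "hadamard_equivalent d H K \<longleftrightarrow> complex_hadamard d H \<and> complex_hadamard d K \<and>
    (\<exists>\<sigma> \<tau> \<alpha> \<beta>. \<sigma> permutes {0..<d} \<and> \<tau> permutes {0..<d} \<and>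
      (\<forall>i<d. cmod (\<alpha> i) = 1) \<and> (\<forall>j<d. cmod (\<beta> j) = 1) \<and>
      K = mat d d (\<lambda>(i, j). \<alpha> i * H $$ (\<sigma> i, \<tau> j) * \<beta> j))"
  unfolding hadamard_equivalent_def complex_hadamard_def
  by (intro conj_cong refl monomial_factorization_iff) auto

text \<open>Multiplying by the conjugate is dividing, since the entries of interest are unimodular.\<close>

definition row_ratio :: "complex mat \<Rightarrow> nat \<Rightarrow> nat \<Rightarrow> nat \<Rightarrow> complex" where
  "row_ratio H i i' k = H $$ (i, k) * cnj (H $$ (i', k))"

lemma row_inner_eq_sum_row_ratio:
  assumes "H \<in> carrier_mat n d" "i < n" "i' < n"
  shows "row H i \<bullet>c row H i' = (\<Sum>k<d. row_ratio H i i' k)"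
  using assms by (auto simp: scalar_prod_def row_ratio_def lessThan_atLeast0)

lemma complex_hadamard_iff:
  "complex_hadamard d H \<longleftrightarrow> H \<in> carrier_mat d d \<and>
     (\<forall>i<d. \<forall>j<d. cmod (H $$ (i, j)) = 1) \<and>
     (\<forall>i<d. \<forall>i'<d. (\<Sum>k<d. row_ratio H i i' k) = (if i = i' then of_nat d else 0))"
proof (cases "H \<in> carrier_mat d d")
  case True
  then have dims: "dim_row (mat_adjoint H) = d" "dim_col (mat_adjoint H) = d"
    by (auto simp: mat_adjoint_def)
  then have entry: "(H * mat_adjoint H) $$ (i, i') = (\<Sum>k<d. row_ratio H i i' k)"
    if "i < d" "i' < d" for i i'
    using True that
    by (auto simp: scalar_prod_def index_mat_adjoint row_ratio_def lessThan_atLeast0)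
  have "H * mat_adjoint H = of_nat d \<cdot>\<^sub>m 1\<^sub>m d \<longleftrightarrow>
      (\<forall>i<d. \<forall>i'<d. (\<Sum>k<d. row_ratio H i i' k) = (if i = i' then of_nat d else 0))"
    using True dims by (simp add: mat_eq_iff entry del: index_mult_mat(1))
  then show ?thesis
    using True by (simp add: complex_hadamard_def)
qed (simp add: complex_hadamard_def)

lemma complex_hadamard_rescale:
  assumes H: "complex_hadamard d H"
    and \<alpha>: "\<And>i. i < d \<Longrightarrow> cmod (\<alpha> i) = 1" and \<beta>: "\<And>j. j < d \<Longrightarrow> cmod (\<beta> j) = 1"
  shows "complex_hadamard d (mat d d (\<lambda>(i, j). \<alpha> i * H $$ (i, j) * \<beta> j))"
    (is "complex_hadamard d ?K")
proof -
  have ratio: "row_ratio ?K i i' k = \<alpha> i * cnj (\<alpha> i') * row_ratio H i i' k"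
    if "i < d" "i' < d" "k < d" for i i' k
  proof -
    have "row_ratio ?K i i' k = \<alpha> i * cnj (\<alpha> i') * row_ratio H i i' k * (\<beta> k * cnj (\<beta> k))"
      using that by (simp add: row_ratio_def mult_ac)
    moreover have "\<beta> k * cnj (\<beta> k) = 1"
      using \<beta> that by (simp add: mult_cnj_eq_1_iff)
    ultimately show ?thesis
      by simp
  qed
  have "(\<Sum>k<d. row_ratio ?K i i' k) = (if i = i' then of_nat d else 0)" if "i < d" "i' < d" for i i'
  proof -
    have "(\<Sum>k<d. row_ratio ?K i i' k) = \<alpha> i * cnj (\<alpha> i') * (\<Sum>k<d. row_ratio H i i' k)"
      using ratio that by (simp add: sum_distrib_left)
    moreover have "\<alpha> i * cnj (\<alpha> i) = 1"
      using \<alpha> that by (simp add: mult_cnj_eq_1_iff)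
    ultimately show ?thesis
      using H that by (auto simp: complex_hadamard_iff)
  qed
  then show ?thesis
    using H \<alpha> \<beta> by (simp add: complex_hadamard_iff norm_mult)
qed

definition haagerup_invariant :: "complex mat \<Rightarrow> nat \<Rightarrow> nat \<Rightarrow> nat \<Rightarrow> nat \<Rightarrow> complex" where
  "haagerup_invariant H i i' j j' = row_ratio H i i' j * cnj (row_ratio H i i' j')"

lemma haagerup_invariant_monomial:
  assumes "\<sigma> permutes {0..<d}" "\<tau> permutes {0..<d}"
    and "\<And>i. i < d \<Longrightarrow> cmod (\<alpha> i) = 1" "\<And>j. j < d \<Longrightarrow> cmod (\<beta> j) = 1"
    and "i < d" "i' < d" "j < d" "j' < d"
  shows "haagerup_invariant (mat d d (\<lambda>(i, j). \<alpha> i * H $$ (\<sigma> i, \<tau> j) * \<beta> j)) i i' j j'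
    = haagerup_invariant H (\<sigma> i) (\<sigma> i') (\<tau> j) (\<tau> j')" (is "haagerup_invariant ?K _ _ _ _ = _")
proof -
  have "haagerup_invariant ?K i i' j j'
      = (\<alpha> i * cnj (\<alpha> i)) * (\<alpha> i' * cnj (\<alpha> i')) * (\<beta> j * cnj (\<beta> j)) * (\<beta> j' * cnj (\<beta> j'))
        * haagerup_invariant H (\<sigma> i) (\<sigma> i') (\<tau> j) (\<tau> j')"
    using assms by (simp add: haagerup_invariant_def row_ratio_def mult_ac)
  moreover have "\<alpha> i * cnj (\<alpha> i) = 1" "\<alpha> i' * cnj (\<alpha> i') = 1" "\<beta> j * cnj (\<beta> j) = 1"
      "\<beta> j' * cnj (\<beta> j') = 1"
    using assms by (simp_all add: mult_cnj_eq_1_iff)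
  ultimately show ?thesis
    by simp
qed

lemma haagerup_invariants_real_if_equivalent_to_real:
  assumes "hadamard_equivalent d H K" and real: "real_hadamard d K"
    and less: "i < d" "i' < d" "j < d" "j' < d"
  shows "haagerup_invariant H i i' j j' \<in> {1, -1}"
proof -
  obtain \<sigma> \<tau> \<alpha> \<beta> where \<sigma>: "\<sigma> permutes {0..<d}" and \<tau>: "\<tau> permutes {0..<d}"
    and \<alpha>: "\<And>i. i < d \<Longrightarrow> cmod (\<alpha> i) = 1" and \<beta>: "\<And>j. j < d \<Longrightarrow> cmod (\<beta> j) = 1"
    and K: "K = mat d d (\<lambda>(i, j). \<alpha> i * H $$ (\<sigma> i, \<tau> j) * \<beta> j)"
    using assms(1) unfolding hadamard_equivalent_iff by blast
  define l l' k k' where preimages: "l = inv_into UNIV \<sigma> i" "l' = inv_into UNIV \<sigma> i'"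
    "k = inv_into UNIV \<tau> j" "k' = inv_into UNIV \<tau> j'"
  then have less': "l < d" "l' < d" "k < d" "k' < d"
    using less permutes_less[OF permutes_inv] \<sigma> \<tau> by blast+
  have K_real: "K $$ (m, n) \<in> {1, -1}" if "m < d" "n < d" for m n
    using real that by (simp add: real_hadamard_def)
  have "haagerup_invariant K l l' k k' = haagerup_invariant H i i' j j'"
    using haagerup_invariant_monomial[where H = H, OF \<sigma> \<tau> \<alpha> \<beta> less']
    by (simp add: K preimages permutes_inverses[OF \<sigma>] permutes_inverses[OF \<tau>])
  moreover have "haagerup_invariant K l l' k k' \<in> {1, -1}"
    using K_real[OF less'(1,3)] K_real[OF less'(1,4)] K_real[OF less'(2,3)] K_real[OF less'(2,4)]
    by (auto simp: haagerup_invariant_def row_ratio_def)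
  ultimately show ?thesis
    by simp
qed

lemma equivalent_to_real_if_haagerup_invariants_real:
  assumes H: "complex_hadamard d H"
    and real: "\<And>i j. i < d \<Longrightarrow> j < d \<Longrightarrow> haagerup_invariant H i 0 j 0 \<in> {1, -1}"
  obtains K where "real_hadamard d K" "hadamard_equivalent d H K"
proof
  define \<alpha> \<beta> where "\<alpha> i = cnj (row_ratio H i 0 0)" and "\<beta> j = cnj (H $$ (0, j))" for i j
  define K where "K = mat d d (\<lambda>(i, j). \<alpha> i * H $$ (i, j) * \<beta> j)"
  have unimodular: "cmod (\<alpha> i) = 1" "cmod (\<beta> i) = 1" if "i < d" for i
    using H that by (auto simp: \<alpha>_def \<beta>_def row_ratio_def complex_hadamard_iff norm_mult)
  then have K_hadamard: "complex_hadamard d K"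
    unfolding K_def by (intro complex_hadamard_rescale H)
  have "K $$ (i, j) = haagerup_invariant H i 0 j 0" if "i < d" "j < d" for i j
    using that by (simp add: K_def \<alpha>_def \<beta>_def haagerup_invariant_def row_ratio_def mult_ac)
  then show "real_hadamard d K"
    using real K_hadamard by (simp add: real_hadamard_def)
  have "K = mat d d (\<lambda>(i, j). \<alpha> i * H $$ (id i, id j) * \<beta> j)"
    by (simp add: K_def)
  then show "hadamard_equivalent d H K"
    unfolding hadamard_equivalent_iff using H K_hadamard unimodular permutes_id by blast
qed

lemma norm_row_ratio:
  "complex_hadamard d H \<Longrightarrow> i < d \<Longrightarrow> i' < d \<Longrightarrow> k < d \<Longrightarrow> cmod (row_ratio H i i' k) = 1"
  by (simp add: row_ratio_def complex_hadamard_iff norm_mult)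

lemma row_ratio_same_row:
  "complex_hadamard d H \<Longrightarrow> i < d \<Longrightarrow> k < d \<Longrightarrow> row_ratio H i i k = 1"
  by (simp add: row_ratio_def complex_hadamard_iff mult_cnj_eq_1_iff)

lemma norm_haagerup_invariant:
  assumes "complex_hadamard d H" "i < d" "i' < d" "j < d" "j' < d"
  shows "cmod (haagerup_invariant H i i' j j') = 1"
  using assms by (simp add: haagerup_invariant_def norm_mult norm_row_ratio)

lemma haagerup_invariant_degenerate:
  assumes "complex_hadamard d H" "i < d" "i' < d" "j < d" "j' < d" "i = i' \<or> j = j'"
  shows "haagerup_invariant H i i' j j' = 1"
  using assms norm_row_ratio[OF assms(1-4)]
  by (auto simp: haagerup_invariant_def row_ratio_same_row mult_cnj_eq_1_iff)

lemma haagerup_invariants_real_if_Re_mult_zero: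
  assumes H: "complex_hadamard d H" and u: "u \<noteq> 0" "Re u = 0"
    and Re_0: "i \<noteq> i' \<Longrightarrow> j \<noteq> j' \<Longrightarrow> Re (u * haagerup_invariant H i i' j j') = 0"
    and less: "i < d" "i' < d" "j < d" "j' < d"
  shows "haagerup_invariant H i i' j j' \<in> {1, -1}"
proof (cases "i = i' \<or> j = j'")
  case True
  then show ?thesis
    using haagerup_invariant_degenerate[OF H less] by simp
next
  case False
  moreover have "Im u \<noteq> 0"
    using u by (simp add: complex_eq_iff)
  ultimately have "Im (haagerup_invariant H i i' j j') = 0"
    using Re_0 u(2) by simp
  then show ?thesis
    using norm_haagerup_invariant[OF H less] unimodular_real_iff by blast
qed

lemma Re_mult_haagerup_invariant_const_iff:
  assumes H: "complex_hadamard d H" and "d > 3" "u \<noteq> 0"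
  shows "(\<forall>i<d. \<forall>i'<d. \<forall>j<d. \<forall>j'<d. i \<noteq> i' \<longrightarrow> j \<noteq> j' \<longrightarrow> Re (u * haagerup_invariant H i i' j j') = t)
    \<longleftrightarrow> Re u = 0 \<and> t = 0 \<and> (\<exists>K. real_hadamard d K \<and> hadamard_equivalent d H K)"
    (is "?const \<longleftrightarrow> _")
proof
  assume const: ?const
  have "Re (u * (row_ratio H 0 1 j * cnj (row_ratio H 0 1 k))) = t"
    if "j \<in> {..<d}" "k \<in> {..<d}" "j \<noteq> k" for j k
    using const assms(2) that by (simp add: haagerup_invariant_def)
  moreover have "sum (row_ratio H 0 1) {..<d} = 0"
    using H assms(2) by (simp add: complex_hadamard_iff)
  ultimately have zero: "Re u = 0" "t = 0"
    using Re_mult_ratios_const_imp_zero[of "{..<d}" "row_ratio H 0 1" u t] norm_row_ratio[OF H] assms(2)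
    by simp_all
  have "haagerup_invariant H i 0 j 0 \<in> {1, -1}" if "i < d" "j < d" for i j
    using const that zero(2)
    by (intro haagerup_invariants_real_if_Re_mult_zero[OF H \<open>u \<noteq> 0\<close> zero(1)]) auto
  then obtain K where "real_hadamard d K" "hadamard_equivalent d H K"
    using equivalent_to_real_if_haagerup_invariants_real[OF H] by blast
  then show "Re u = 0 \<and> t = 0 \<and> (\<exists>K. real_hadamard d K \<and> hadamard_equivalent d H K)"
    using zero by blast
next
  assume zero_and_equivalent:
    "Re u = 0 \<and> t = 0 \<and> (\<exists>K. real_hadamard d K \<and> hadamard_equivalent d H K)"
  then have "haagerup_invariant H i i' j j' \<in> {1, -1}"
    if "i < d" "i' < d" "j < d" "j' < d" for i i' j j'
    using haagerup_invariants_real_if_equivalent_to_real that by blast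
  then have "Im (haagerup_invariant H i i' j j') = 0"
    if "i < d" "i' < d" "j < d" "j' < d" for i i' j j'
    using that by (metis unimodular_real_iff)
  then show ?const
    using zero_and_equivalent by simp
qed

section \<open>Equiangular lines\<close>

lemma norm_inner_squared_if_same_line:
  assumes x: "x \<in> carrier_vec d" and y: "y \<in> carrier_vec d"
    and line: "complex_line x = complex_line y"
  shows "(cmod (x \<bullet>c y))\<^sup>2 = cmod (x \<bullet>c x) * cmod (y \<bullet>c y)"
proof -
  have "1 \<cdot>\<^sub>v y \<in> complex_line y"
    unfolding complex_line_def by blast
  then obtain a where a: "y = a \<cdot>\<^sub>v x"
    using line by (auto simp: complex_line_def)
  have "conjugate y = cnj a \<cdot>\<^sub>v conjugate x"
    using a by (simp add: conjugate_smult_vec)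
  then show ?thesis
    using x by (simp add: a norm_mult power2_eq_square)
qed

lemma equiangular_lines_imageI:
  assumes "finite I" and carrier: "\<And>p. p \<in> I \<Longrightarrow> u p \<in> carrier_vec d" and "c \<ge> 0"
    and self: "\<And>p. p \<in> I \<Longrightarrow> cmod (u p \<bullet>c u p) > c"
    and distinct: "\<And>p q. p \<in> I \<Longrightarrow> q \<in> I \<Longrightarrow> p \<noteq> q \<Longrightarrow> cmod (u p \<bullet>c u q) = c"
  shows "equiangular_lines d (card I) (u ` I)"
proof -
  have "p = q" if "p \<in> I" "q \<in> I" "complex_line (u p) = complex_line (u q)" for p q
  proof (rule ccontr)
    assume "p \<noteq> q"
    then have "c * c = cmod (u p \<bullet>c u p) * cmod (u q \<bullet>c u q)"
      using norm_inner_squared_if_same_line[OF carrier carrier that(3)] distinct that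
      by (simp add: power2_eq_square)
    moreover have "c * c < cmod (u p \<bullet>c u p) * cmod (u q \<bullet>c u q)"
      using self that \<open>c \<ge> 0\<close> by (intro mult_strict_mono') auto
    ultimately show False
      by simp
  qed
  then have "inj_on u I" "inj_on complex_line (u ` I)"
    by (auto intro!: inj_onI)
  moreover have "0\<^sub>v d \<notin> u ` I"
  proof
    assume "0\<^sub>v d \<in> u ` I"
    then obtain p where "p \<in> I" "u p = 0\<^sub>v d"
      by auto
    then show False
      using self[of p] \<open>c \<ge> 0\<close> by simp
  qed
  ultimately show ?thesis
    unfolding equiangular_lines_def using assms(1) carrier distinct
    by (auto simp: card_image intro!: exI[of _ c])
qed

lemma equiangular_lines_imageE:
  assumes "equiangular_lines d (card I) (u ` I)" "finite I"
  obtains c where "\<And>p q. p \<in> I \<Longrightarrow> q \<in> I \<Longrightarrow> p \<noteq> q \<Longrightarrow> cmod (u p \<bullet>c u q) = c"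
proof -
  have "inj_on u I"
    using assms by (intro eq_card_imp_inj_on) (auto simp: equiangular_lines_def)
  then show ?thesis
    using assms(1) that by (fastforce simp: equiangular_lines_def inj_on_eq_iff)
qed

lemma scale_coord_inner:
  assumes "x \<in> carrier_vec d" "y \<in> carrier_vec d" "j < d" "j' < d"
  shows "scale_coord j v x \<bullet>c scale_coord j' v y = x \<bullet>c y +
    (if j = j' then of_real ((cmod v)\<^sup>2 - 1) * (x $ j * cnj (y $ j))
     else (v - 1) * (x $ j * cnj (y $ j)) + cnj (v - 1) * (x $ j' * cnj (y $ j')))"
    (is "?lhs = ?rhs")
proof -
  let ?p = "\<lambda>k. x $ k * cnj (y $ k)"
  have "?lhs = (\<Sum>k<d. (if k = j then v else 1) * (if k = j' then cnj v else 1) * ?p k)"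
    using assms by (auto simp: scale_coord_def scalar_prod_def lessThan_atLeast0 intro!: sum.cong)
  also have "\<dots> = (\<Sum>k<d. ?p k
      + (if k = j then (if j = j' then v * cnj v - 1 else v - 1) * ?p j else 0)
      + (if k = j' then (if j = j' then 0 else cnj v - 1) * ?p j' else 0))"
    by (intro sum.cong) (auto simp: algebra_simps)
  also have "\<dots> = (\<Sum>k<d. ?p k) + (if j = j' then v * cnj v - 1 else v - 1) * ?p j
      + (if j = j' then 0 else cnj v - 1) * ?p j'"
    using assms by (simp add: sum.distrib)
  also have "\<dots> = ?rhs"
    using assms by (auto simp: scalar_prod_def lessThan_atLeast0 simp flip: complex_norm_square)
  finally show ?thesis .
qed

definition scaled_row :: "complex mat \<Rightarrow> complex \<Rightarrow> nat \<times> nat \<Rightarrow> complex vec" where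
  "scaled_row H v = (\<lambda>(i, j). scale_coord j v (row H i))"

lemma scaled_row_carrier: "H \<in> carrier_mat n d \<Longrightarrow> scaled_row H v p \<in> carrier_vec d"
  by (auto simp: scaled_row_def scale_coord_def split: prod.split)

lemma hadamard_vectors_eq_image:
  "H \<in> carrier_mat n d \<Longrightarrow> hadamard_vectors H v = scaled_row H v ` ({..<n} \<times> {..<d})"
  by (fastforce simp: hadamard_vectors_def hadamard_coord_vectors_def scaled_row_def)

context
  fixes d H i i' j j' and v :: complex
  assumes H: "complex_hadamard d H" and less: "i < d" "i' < d" "j < d" "j' < d"
begin

lemma scaled_row_inner:
  "scaled_row H v (i, j) \<bullet>c scaled_row H v (i', j') = (if i = i' then of_nat d else 0) +
    (if j = j' then of_real ((cmod v)\<^sup>2 - 1) * row_ratio H i i' j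
     else (v - 1) * row_ratio H i i' j + cnj (v - 1) * row_ratio H i i' j')"
proof -
  have carrier: "H \<in> carrier_mat d d"
    using H by (simp add: complex_hadamard_iff)
  have "row H i \<bullet>c row H i' = (if i = i' then of_nat d else 0)"
    using H less row_inner_eq_sum_row_ratio[OF carrier] by (simp add: complex_hadamard_iff)
  then show ?thesis
    using carrier less by (simp add: scaled_row_def scale_coord_inner[of _ d] row_ratio_def)
qed

lemma norm_scaled_row_inner_same_coord:
  assumes "i \<noteq> i'" "j = j'"
  shows "cmod (scaled_row H v (i, j) \<bullet>c scaled_row H v (i', j')) = \<bar>(cmod v)\<^sup>2 - 1\<bar>"
  unfolding scaled_row_inner using assms norm_row_ratio[OF H less(1-3)]
  by (simp add: norm_mult del: of_real_diff)

lemma norm_scaled_row_inner_same_row: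
  assumes "i = i'" "j \<noteq> j'"
  shows "cmod (scaled_row H v (i, j) \<bullet>c scaled_row H v (i', j')) = \<bar>real d - 2 + 2 * Re v\<bar>"
proof -
  have "scaled_row H v (i, j) \<bullet>c scaled_row H v (i', j') = of_nat d + (v - 1 + cnj (v - 1))"
    unfolding scaled_row_inner using assms less row_ratio_same_row[OF H] by simp
  also have "\<dots> = of_real (real d - 2 + 2 * Re v)"
    unfolding complex_add_cnj by simp
  finally show ?thesis
    by (simp only: norm_of_real)
qed

lemma norm_scaled_row_inner_self:
  assumes "i = i'" "j = j'"
  shows "cmod (scaled_row H v (i, j) \<bullet>c scaled_row H v (i', j')) = real d + (cmod v)\<^sup>2 - 1"
proof -
  have "scaled_row H v (i, j) \<bullet>c scaled_row H v (i', j') = of_real (real d + (cmod v)\<^sup>2 - 1)"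
    unfolding scaled_row_inner using assms less row_ratio_same_row[OF H] by simp
  moreover have "real d + (cmod v)\<^sup>2 - 1 \<ge> 0"
    using less(1) zero_le_power2[of "cmod v"] by linarith
  ultimately show ?thesis
    by (simp only: norm_of_real abs_of_nonneg)
qed

lemma norm_scaled_row_inner_eq_iff:
  assumes "i \<noteq> i'" "j \<noteq> j'" "c \<ge> 0"
  shows "cmod (scaled_row H v (i, j) \<bullet>c scaled_row H v (i', j')) = c \<longleftrightarrow>
    Re ((v - 1)\<^sup>2 * haagerup_invariant H i i' j j') = c\<^sup>2 / 2 - (cmod (v - 1))\<^sup>2"
    (is "cmod ?inner = c \<longleftrightarrow> _")
proof -
  have "(cmod ?inner)\<^sup>2 = 2 * (cmod (v - 1))\<^sup>2 + 2 * Re ((v - 1)\<^sup>2 * haagerup_invariant H i i' j j')"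
    unfolding scaled_row_inner haagerup_invariant_def
    using assms less norm_row_ratio[OF H less(1,2)]
    by (simp add: cmod_mult_add_cnj_mult_squared del: times_complex.sel complex_cnj_diff)
  moreover have "cmod ?inner = c \<longleftrightarrow> (cmod ?inner)\<^sup>2 = c\<^sup>2"
    using assms(3) by (simp only: power2_eq_iff_nonneg norm_ge_zero)
  ultimately show ?thesis
    by argo
qed

end

lemma scaled_row_inner_const_iff:
  assumes H: "complex_hadamard d H" and "d > 1" "c \<ge> 0"
  shows "(\<forall>p\<in>{..<d} \<times> {..<d}. \<forall>q\<in>{..<d} \<times> {..<d}. p \<noteq> q \<longrightarrow>
        cmod (scaled_row H v p \<bullet>c scaled_row H v q) = c) \<longleftrightarrow>
    c = \<bar>(cmod v)\<^sup>2 - 1\<bar> \<and> \<bar>real d - 2 + 2 * Re v\<bar> = \<bar>(cmod v)\<^sup>2 - 1\<bar> \<and>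
    (\<forall>i<d. \<forall>i'<d. \<forall>j<d. \<forall>j'<d. i \<noteq> i' \<longrightarrow> j \<noteq> j' \<longrightarrow>
      Re ((v - 1)\<^sup>2 * haagerup_invariant H i i' j j')
        = ((cmod v)\<^sup>2 - 1)\<^sup>2 / 2 - (cmod (v - 1))\<^sup>2)"
    (is "?const \<longleftrightarrow> ?same_coord \<and> ?same_row \<and> ?distinct")
proof
  assume ?const
  then have const: "cmod (scaled_row H v (i, j) \<bullet>c scaled_row H v (i', j')) = c"
    if "i < d" "i' < d" "j < d" "j' < d" "(i, j) \<noteq> (i', j')" for i i' j j'
    using that by blast
  have same_coord: ?same_coord
    using const[of 0 1 0 0] norm_scaled_row_inner_same_coord[OF H, of 0 1 0 0 v] assms(2) by simp
  then have c_squared: "c\<^sup>2 = ((cmod v)\<^sup>2 - 1)\<^sup>2"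
    by simp
  have ?same_row
    using const[of 0 0 0 1] norm_scaled_row_inner_same_row[OF H, of 0 0 0 1 v] same_coord assms(2)
    by simp
  moreover have ?distinct
    using const norm_scaled_row_inner_eq_iff[OF H _ _ _ _ _ _ assms(3), unfolded c_squared] by blast
  ultimately show "?same_coord \<and> ?same_row \<and> ?distinct"
    using same_coord by blast
next
  assume conditions: "?same_coord \<and> ?same_row \<and> ?distinct"
  then have c_squared: "c\<^sup>2 = ((cmod v)\<^sup>2 - 1)\<^sup>2"
    by simp
  have "cmod (scaled_row H v (i, j) \<bullet>c scaled_row H v (i', j')) = c"
    if less: "i < d" "i' < d" "j < d" "j' < d" and neq: "(i, j) \<noteq> (i', j')" for i i' j j'
  proof -
    consider "i \<noteq> i'" "j = j'" | "i = i'" "j \<noteq> j'" | "i \<noteq> i'" "j \<noteq> j'"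
      using neq by blast
    then show ?thesis
      using norm_scaled_row_inner_same_coord[OF H less] norm_scaled_row_inner_same_row[OF H less]
        norm_scaled_row_inner_eq_iff[OF H less _ _ assms(3), unfolded c_squared] conditions less
      by cases metis+
  qed
  then show ?const
    by auto
qed

lemma hadamard_vectors_equiangular_iff:
  assumes H: "complex_hadamard d H" and "d > 2"
  shows "equiangular_lines d (d\<^sup>2) (hadamard_vectors H v) \<longleftrightarrow>
    \<bar>real d - 2 + 2 * Re v\<bar> = \<bar>(cmod v)\<^sup>2 - 1\<bar> \<and>
    (\<forall>i<d. \<forall>i'<d. \<forall>j<d. \<forall>j'<d. i \<noteq> i' \<longrightarrow> j \<noteq> j' \<longrightarrow>
      Re ((v - 1)\<^sup>2 * haagerup_invariant H i i' j j')
        = ((cmod v)\<^sup>2 - 1)\<^sup>2 / 2 - (cmod (v - 1))\<^sup>2)"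
    (is "_ \<longleftrightarrow> ?conditions")
proof -
  define I u where "I = {..<d} \<times> {..<d}" and "u = scaled_row H v"
  have H_carrier: "H \<in> carrier_mat d d"
    using H by (simp add: complex_hadamard_iff)
  have I: "finite I" "d\<^sup>2 = card I"
    by (simp_all add: I_def power2_eq_square)
  have const_iff: "(\<forall>p\<in>I. \<forall>q\<in>I. p \<noteq> q \<longrightarrow> cmod (u p \<bullet>c u q) = c) \<longleftrightarrow>
      c = \<bar>(cmod v)\<^sup>2 - 1\<bar> \<and> ?conditions" if "c \<ge> 0" for c
    unfolding I_def u_def using assms(2) that by (intro scaled_row_inner_const_iff H) auto
  show ?thesis
    unfolding hadamard_vectors_eq_image[OF H_carrier] I(2) I_def[symmetric] u_def[symmetric]
  proof
    assume "equiangular_lines d (card I) (u ` I)"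
    then obtain c where c: "\<And>p q. p \<in> I \<Longrightarrow> q \<in> I \<Longrightarrow> p \<noteq> q \<Longrightarrow> cmod (u p \<bullet>c u q) = c"
      using equiangular_lines_imageE[OF _ I(1)] by blast
    have "cmod (u (0, 0) \<bullet>c u (0, 1)) = c"
      using assms(2) by (intro c) (simp_all add: I_def)
    then have "c \<ge> 0"
      using norm_ge_zero by blast
    then show ?conditions
      using const_iff c by blast
  next
    assume ?conditions
    define c where "c = \<bar>(cmod v)\<^sup>2 - 1\<bar>"
    have distinct: "\<And>p q. p \<in> I \<Longrightarrow> q \<in> I \<Longrightarrow> p \<noteq> q \<Longrightarrow> cmod (u p \<bullet>c u q) = c"
      using const_iff[of c] \<open>?conditions\<close> by (simp add: c_def)
    have "c < real d + (cmod v)\<^sup>2 - 1"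
      unfolding c_def using assms(2) zero_le_power2[of "cmod v"] by linarith
    then have self: "cmod (u p \<bullet>c u p) > c" if "p \<in> I" for p
      using that norm_scaled_row_inner_self[OF H] by (auto simp: I_def u_def)
    show "equiangular_lines d (card I) (u ` I)"
      using I(1) self distinct scaled_row_carrier[OF H_carrier]
      by (intro equiangular_lines_imageI[where c = c]) (auto simp: u_def c_def)
  qed
qed

lemma scaling_factor_iff:
  "v \<noteq> 1 \<and> Re ((v - 1)\<^sup>2) = 0 \<and> ((cmod v)\<^sup>2 - 1)\<^sup>2 = 2 * (cmod (v - 1))\<^sup>2 \<longleftrightarrow>
    v \<in> {-1 + 2 * \<i>, -1 - 2 * \<i>}"
proof
  define a b where "a = Re v - 1" and "b = Im v"
  then have v: "v = Complex (1 + a) b"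
    by simp
  assume "v \<noteq> 1 \<and> Re ((v - 1)\<^sup>2) = 0 \<and> ((cmod v)\<^sup>2 - 1)\<^sup>2 = 2 * (cmod (v - 1))\<^sup>2"
  then have "v \<noteq> 1" and b_sq: "b\<^sup>2 = a\<^sup>2" and norms: "((1 + a)\<^sup>2 + b\<^sup>2 - 1)\<^sup>2 = 2 * (a\<^sup>2 + b\<^sup>2)"
    unfolding cmod_power2 v by (simp_all add: power2_eq_square)
  then have "a \<noteq> 0"
    by (auto simp: v complex_eq_iff)
  have "(2 * a)\<^sup>2 * (a + 1)\<^sup>2 = ((1 + a)\<^sup>2 + b\<^sup>2 - 1)\<^sup>2"
    unfolding b_sq by (simp add: algebra_simps power2_eq_square)
  also have "\<dots> = (2 * a)\<^sup>2 * 1"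
    using norms by (simp add: b_sq power_mult_distrib)
  finally have "(a + 1)\<^sup>2 = 1"
    using \<open>a \<noteq> 0\<close> by simp
  then have a: "a = -2"
    using \<open>a \<noteq> 0\<close> by (auto simp: power2_eq_1_iff)
  then have "b\<^sup>2 = 2\<^sup>2"
    using b_sq by simp
  then have "b = 2 \<or> b = -2"
    by (simp only: power2_eq_iff)
  then show "v \<in> {-1 + 2 * \<i>, -1 - 2 * \<i>}"
    by (auto simp: v a complex_eq_iff)
next
  assume "v \<in> {-1 + 2 * \<i>, -1 - 2 * \<i>}"
  then show "v \<noteq> 1 \<and> Re ((v - 1)\<^sup>2) = 0 \<and> ((cmod v)\<^sup>2 - 1)\<^sup>2 = 2 * (cmod (v - 1))\<^sup>2"
    unfolding cmod_power2 by (auto simp: power2_eq_square complex_eq_iff)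
qed

lemma order_iff_if_scaling_factor:
  assumes "v \<in> {-1 + 2 * \<i>, -1 - 2 * \<i>}" "d > 0"
  shows "\<bar>real d - 2 + 2 * Re v\<bar> = \<bar>(cmod v)\<^sup>2 - 1\<bar> \<longleftrightarrow> d = 8"
  using assms unfolding cmod_power2 by auto

theorem theorem3p5:
  fixes d :: nat and H :: "complex mat" and v :: complex
  assumes "d > 3"
    and "complex_hadamard d H"
  shows "equiangular_lines d (d\<^sup>2) (hadamard_vectors H v) \<longleftrightarrow>
           d = 8 \<and> (\<exists>K. real_hadamard d K \<and> hadamard_equivalent d H K) \<and>
           v \<in> {-1 + 2 * \<i>, -1 - 2 * \<i>}"
proof (cases "v = 1")
  case True
  then show ?thesis
    using assms scaling_factor_iff[of v] by (auto simp: hadamard_vectors_equiangular_iff)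
next
  case False
  let ?equal_moduli = "\<bar>real d - 2 + 2 * Re v\<bar> = \<bar>(cmod v)\<^sup>2 - 1\<bar>"
  let ?equivalent = "\<exists>K. real_hadamard d K \<and> hadamard_equivalent d H K"
  define t where "t = ((cmod v)\<^sup>2 - 1)\<^sup>2 / 2 - (cmod (v - 1))\<^sup>2"
  have "equiangular_lines d (d\<^sup>2) (hadamard_vectors H v) \<longleftrightarrow> ?equal_moduli \<and>
      (\<forall>i<d. \<forall>i'<d. \<forall>j<d. \<forall>j'<d. i \<noteq> i' \<longrightarrow> j \<noteq> j' \<longrightarrow>
        Re ((v - 1)\<^sup>2 * haagerup_invariant H i i' j j') = t)"
    unfolding t_def using assms by (intro hadamard_vectors_equiangular_iff) auto
  also have "\<dots> \<longleftrightarrow> ?equal_moduli \<and> Re ((v - 1)\<^sup>2) = 0 \<and> t = 0 \<and> ?equivalent"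
    using Re_mult_haagerup_invariant_const_iff[of d H "(v - 1)\<^sup>2" t] assms False by simp
  also have "\<dots> \<longleftrightarrow> ?equal_moduli \<and> v \<in> {-1 + 2 * \<i>, -1 - 2 * \<i>} \<and> ?equivalent"
    using scaling_factor_iff[of v] False by (auto simp: t_def)
  also have "\<dots> \<longleftrightarrow> d = 8 \<and> ?equivalent \<and> v \<in> {-1 + 2 * \<i>, -1 - 2 * \<i>}"
    using order_iff_if_scaling_factor[of v d] assms(1) by auto
  finally show ?thesis .
qed

end
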